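(* Let $\theta=\sqrt{b/a}$ with $a<b$ coprime positive integers not both perfect squares. For all $C,D>0$ there exist $\varepsilon>\eta>C$ with $\varepsilon-\eta<D$ such that $$0=\liminf_{B\to\infty}\delta_{\theta,B,1/2}(\chi_{\varepsilon,\eta})<\limsup_{B\to\infty}\delta_{\theta,B,1/2}(\chi_{\varepsilon,\eta})=O_{\varepsilon,\eta}(1).$$ In particular, the measures $\delta_{\theta,B,1/2}$ have no limit measure as $B\to\infty$.
   Context: On $\mathbb{P}^1(\mathbb{Q})$ use the height $H([u:v])=\max(|u|,|v|)$ with $u,v$ coprime integers. For a real number $\theta$, $r>0$, $B>0$ and $f$ a compactly supported function on $\mathbb{R}$, set $\delta_{\theta,B,r}(f)=\sum_{[u:v]\in\mathbb{P}^1(\mathbb{Q}),\,v\ne0,\,H([u:v])\le B}f\big(B^{1/r}(u/v-\theta)\big)$. For $\varepsilon>\eta\ge0$, $\chi_{\varepsilon,\eta}$ is the indicator function of $\{t\in\mathbb{R}:\eta<|t|\le\varepsilon\}$ and $\chi_\varepsilon=\chi_{\varepsilon,0}$ is that of $\{|t|\le\varepsilon\}$. *)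

theory Defs
  imports Complex_Main "HOL-Library.Extended_Real" "HOL-Library.Liminf_Limsup"
begin

text \<open>Points of P^1(Q) with v nonzero are represented uniquely by coprime (u,v) with v > 0;
  H([u:v]) = max(|u|,|v|).\<close>
definition delta :: "real \<Rightarrow> real \<Rightarrow> real \<Rightarrow> (real \<Rightarrow> real) \<Rightarrow> real" where
  "delta \<theta> B r f =
     (\<Sum>p \<in> {(u :: int, v :: int). 0 < v \<and> coprime u v \<and> max \<bar>real_of_int u\<bar> \<bar>real_of_int v\<bar> \<le> B}.
        f (B powr (1 / r) * (real_of_int (fst p) / real_of_int (snd p) - \<theta>)))"

definition chi :: "real \<Rightarrow> real \<Rightarrow> real \<Rightarrow> real" where
  "chi \<epsilon> \<eta> t = (if \<eta> < \<bar>t\<bar> \<and> \<bar>t\<bar> \<le> \<epsilon> then 1 else 0)"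

end

theory Submission
  imports Defs "HOL-Analysis.Kronecker_Approximation_Theorem"
begin

text \<open>Reduced fractions with denominators at most \<open>Q\<close> are \<open>1/Q\<^sup>2\<close>-separated, so a window of
  width \<open>2\<epsilon>/B\<^sup>2\<close> around \<open>\<theta>\<close> contains at most \<open>2\<epsilon> + 1\<close> points of height \<open>\<le> B\<close>: the limsup is finite.
  Since \<open>\<theta>\<close> is irrational, it has infinitely many approximations \<open>|h/k - \<theta>| < 1/k\<^sup>2\<close>, and each of
  them lies on the outer boundary of the shell \<open>\<eta> < B\<^sup>2|u/v - \<theta>| \<le> \<epsilon>\<close> for a suitable large \<open>B\<close>:
  the limsup is positive. Conversely, if the shell were nonempty at all large scales, a thin shell
  (\<open>\<epsilon>/\<eta>\<close> close to \<open>1\<close>) at \<open>4\<epsilon> + 2\<close> geometrically spaced scales within a factor \<open>\<surd>2\<close> would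
  yield that many distinct points in a window too small to hold them: the liminf is zero.\<close>

lemma Liminf_le_if_frequently:
  fixes f :: "'a \<Rightarrow> 'b :: complete_linorder"
  assumes "\<exists>\<^sub>F x in F. f x \<le> c"
  shows "Liminf F f \<le> c"
proof (rule ccontr)
  assume "\<not> Liminf F f \<le> c"
  then have "\<forall>\<^sub>F x in F. f x \<le> c \<longrightarrow> False"
    by (auto simp: not_le dest: less_LiminfD elim: eventually_mono)
  from frequently_rev_mp[OF assms this] show False by simp
qed

lemma Limsup_ge_if_frequently:
  fixes f :: "'a \<Rightarrow> 'b :: complete_linorder"
  assumes "\<exists>\<^sub>F x in F. c \<le> f x"
  shows "c \<le> Limsup F f"
proof (rule ccontr)
  assume "\<not> c \<le> Limsup F f"
  then have "\<forall>\<^sub>F x in F. c \<le> f x \<longrightarrow> False"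
    by (auto simp: not_le dest: Limsup_lessD elim: eventually_mono)
  from frequently_rev_mp[OF assms this] show False by simp
qed

lemma frequently_at_top_linorder:
  "(\<exists>\<^sub>F x in at_top. P x) \<longleftrightarrow> (\<forall>N. \<exists>x\<ge>N. P (x :: 'a :: linorder))"
  by (auto simp: frequently_def eventually_at_top_linorder)

lemma sqrt_ratio_irrational:
  fixes a b :: nat
  assumes "0 < a" "0 < b" "coprime a b" "\<not> ((\<exists>k. a = k ^ 2) \<and> (\<exists>k. b = k ^ 2))"
  shows "sqrt (real b / real a) \<notin> \<rat>"
proof
  assume "sqrt (real b / real a) \<in> \<rat>"
  then obtain m n :: nat where n0: "n \<noteq> 0" and e: "\<bar>sqrt (real b / real a)\<bar> = real m / real n"
    and cop: "coprime m n"
    by (rule Rats_abs_nat_div_natE)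
  have "real b / real a = (real m / real n) ^ 2"
    using e real_sqrt_pow2[of "real b / real a"] by simp
  then have "real b * real n ^ 2 = real a * real m ^ 2"
    using assms(1) n0 by (simp add: field_simps power_divide)
  then have eq: "b * n ^ 2 = a * m ^ 2" by (metis of_nat_eq_iff of_nat_mult of_nat_power)
  have m0: "m \<noteq> 0"
  proof
    assume "m = 0"
    then show False using eq assms(2) n0 by simp
  qed
  have c2: "coprime (m ^ 2) (n ^ 2)" using cop by simp
  have "m ^ 2 dvd b * n ^ 2" using eq by simp
  then have "m ^ 2 dvd b" using c2 by (simp add: coprime_dvd_mult_left_iff)
  then obtain x where bx: "b = m ^ 2 * x" ..
  have "n ^ 2 dvd a * m ^ 2" using eq by (metis dvd_triv_right)
  then have "n ^ 2 dvd a" using c2 by (simp add: coprime_commute coprime_dvd_mult_left_iff)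
  then obtain y where ay: "a = n ^ 2 * y" ..
  have "m ^ 2 * n ^ 2 * x = m ^ 2 * n ^ 2 * y" using eq bx ay by (simp add: ac_simps)
  then have "x = y" using m0 n0 by simp
  then have "x = 1" using assms(3) ay bx by (simp add: coprime_common_divisor_nat)
  then show False using assms(4) ay bx \<open>x = y\<close> by auto
qed

lemma reduced_fractions_separated:
  fixes u v u' v' :: int and Q :: real
  assumes "coprime u v" "coprime u' v'" "0 < v" "0 < v'" "v \<le> Q" "v' \<le> Q" "(u, v) \<noteq> (u', v')"
  shows "1 / Q ^ 2 \<le> \<bar>u / v - u' / v'\<bar>"
proof -
  have "u * v' \<noteq> u' * v"
  proof
    assume eq: "u * v' = u' * v"
    then have "\<bar>u\<bar> * \<bar>v'\<bar> = \<bar>u'\<bar> * \<bar>v\<bar>" by (simp flip: abs_mult)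
    then have "v = v'"
      using coprime_crossproduct_int[OF assms(1,2)] assms(3,4) by simp
    then show False using eq assms(4,7) by simp
  qed
  then have cross: "1 \<le> \<bar>real_of_int (u * v' - u' * v)\<bar>" by linarith
  have "real_of_int v * real_of_int v' \<le> Q ^ 2"
    using assms(3-6) by (simp add: power2_eq_square mult_mono)
  then have "1 / Q ^ 2 \<le> 1 / (real_of_int v * real_of_int v')"
    using assms(3,4) by (simp add: frac_le)
  also have "\<dots> \<le> \<bar>real_of_int (u * v' - u' * v)\<bar> / (real_of_int v * real_of_int v')"
    using cross assms(3,4) by (simp add: divide_right_mono)
  also have "\<dots> = \<bar>u / v - u' / v'\<bar>"
    using assms(3,4) by (simp add: field_simps abs_divide abs_mult)
  finally show ?thesis .
qed

text \<open>By the separation, \<open>p \<mapsto> \<lfloor>(p - c + r) Q\<^sup>2\<rfloor>\<close> injects \<open>A\<close> into \<open>{0..\<lfloor>2 r Q\<^sup>2\<rfloor>}\<close>.\<close>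
lemma card_reduced_fractions_near:
  fixes A :: "(int \<times> int) set" and Q c r :: real
  assumes "0 \<le> r"
    and A: "\<And>u v. (u, v) \<in> A \<Longrightarrow> coprime u v \<and> 0 < v \<and> v \<le> Q \<and> \<bar>u / v - c\<bar> \<le> r"
  shows "finite A" and "card A \<le> 2 * r * Q ^ 2 + 1"
proof -
  define x where "x = (\<lambda>(u, v). (real_of_int u / real_of_int v - c + r) * Q ^ 2)"
  define f where "f = (\<lambda>p. \<lfloor>x p\<rfloor>)"
  have im: "f ` A \<subseteq> {0..\<lfloor>2 * r * Q ^ 2\<rfloor>}"
  proof clarify
    fix u v assume "(u, v) \<in> A"
    then have "0 \<le> x (u, v)" "x (u, v) \<le> 2 * r * Q ^ 2"
      using A[of u v] unfolding x_def by (auto intro: mult_right_mono simp: abs_le_iff)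
    then show "f (u, v) \<in> {0..\<lfloor>2 * r * Q ^ 2\<rfloor>}" unfolding f_def by (auto intro: floor_mono)
  qed
  have "inj_on f A"
  proof (rule inj_onI, rule ccontr)
    fix p p' assume p: "p \<in> A" "p' \<in> A" "f p = f p'" "p \<noteq> p'"
    obtain u v u' v' where [simp]: "p = (u, v)" "p' = (u', v')" by fastforce
    have "1 / Q ^ 2 \<le> \<bar>u / v - u' / v'\<bar>"
      using A[of u v] A[of u' v'] p by (intro reduced_fractions_separated) auto
    moreover have "Q ^ 2 > 0" using A[of u v] p by auto
    moreover have "x p - x p' = (u / v - u' / v') * Q ^ 2"
      unfolding x_def by (simp add: algebra_simps)
    ultimately have "1 \<le> \<bar>x p - x p'\<bar>"
      by (simp add: abs_mult divide_le_eq)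
    moreover have "\<bar>x p - x p'\<bar> < 1" using p(3) unfolding f_def by linarith
    ultimately show False by simp
  qed
  then show "finite A" using im finite_imageD finite_subset by blast
  have "card A \<le> card {0..\<lfloor>2 * r * Q ^ 2\<rfloor>}"
    using card_mono[OF _ im] card_image[OF \<open>inj_on f A\<close>] by simp
  also have "real \<dots> \<le> 2 * r * Q ^ 2 + 1"
    using assms(1) by simp
  finally show "card A \<le> 2 * r * Q ^ 2 + 1" by simp
qed

definition points_of_height_le :: "real \<Rightarrow> (int \<times> int) set" where
  "points_of_height_le B =
     {(u, v). 0 < v \<and> coprime u v \<and> max \<bar>real_of_int u\<bar> \<bar>real_of_int v\<bar> \<le> B}"

definition shell_points :: "real \<Rightarrow> real \<Rightarrow> real \<Rightarrow> real \<Rightarrow> (int \<times> int) set" where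
  "shell_points \<theta> \<epsilon> \<eta> B =
     {p \<in> points_of_height_le B.
        \<eta> < \<bar>B\<^sup>2 * (fst p / snd p - \<theta>)\<bar> \<and> \<bar>B\<^sup>2 * (fst p / snd p - \<theta>)\<bar> \<le> \<epsilon>}"

lemma finite_points_of_height_le: "finite (points_of_height_le B)"
proof (rule finite_subset)
  show "points_of_height_le B \<subseteq> {-\<lceil>B\<rceil>..\<lceil>B\<rceil>} \<times> {-\<lceil>B\<rceil>..\<lceil>B\<rceil>}"
  proof -
    have "w \<in> {-\<lceil>B\<rceil>..\<lceil>B\<rceil>}" if "\<bar>real_of_int w\<bar> \<le> B" for w :: int
    proof -
      have "real_of_int \<bar>w\<bar> \<le> real_of_int \<lceil>B\<rceil>" using that le_of_int_ceiling[of B] by (metis of_int_abs order_trans)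
      then have "\<bar>w\<bar> \<le> \<lceil>B\<rceil>" by (simp only: of_int_le_iff)
      then show ?thesis by auto
    qed
    then show ?thesis unfolding points_of_height_le_def by auto
  qed
qed simp

lemma finite_shell_points: "finite (shell_points \<theta> \<epsilon> \<eta> B)"
  unfolding shell_points_def using finite_points_of_height_le by (rule finite_subset[rotated]) auto

lemma delta_chi_eq_card_shell_points:
  assumes "0 < B"
  shows "delta \<theta> B (1/2) (chi \<epsilon> \<eta>) = card (shell_points \<theta> \<epsilon> \<eta> B)"
proof -
  have "B powr (1 / (1/2)) = B\<^sup>2" using assms by (simp add: powr_numeral)
  then show ?thesis
    unfolding delta_def chi_def shell_points_def points_of_height_le_def[symmetric]
    by (simp add: sum.inter_filter[OF finite_points_of_height_le, symmetric])
qed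

lemma shell_pointsD:
  assumes "(u, v) \<in> shell_points \<theta> \<epsilon> \<eta> B" "0 < B"
  shows "coprime u v \<and> 0 < v \<and> v \<le> B \<and> \<bar>u / v - \<theta>\<bar> \<le> \<epsilon> / B\<^sup>2"
  using assms
  by (auto simp: shell_points_def points_of_height_le_def abs_mult pos_le_divide_eq mult.commute)

lemma card_shell_points_le:
  fixes \<epsilon> :: real
  assumes "0 < B" "0 \<le> \<epsilon>"
  shows "card (shell_points \<theta> \<epsilon> \<eta> B) \<le> 2 * \<epsilon> + 1"
proof -
  have "card (shell_points \<theta> \<epsilon> \<eta> B) \<le> 2 * (\<epsilon> / B\<^sup>2) * B\<^sup>2 + 1"
    using assms shell_pointsD[OF _ assms(1)] by (intro card_reduced_fractions_near[where c = \<theta>]) auto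
  then show ?thesis using assms(1) by simp
qed

text \<open>A point of the shell at scale \<open>B\<close> satisfies \<open>\<eta> / B\<^sup>2 < |u/v - \<theta>| \<le> \<epsilon> / B\<^sup>2\<close>.\<close>
lemma shell_points_disjoint:
  assumes "B' \<noteq> 0" "\<epsilon> * B\<^sup>2 \<le> \<eta> * B'\<^sup>2"
  shows "shell_points \<theta> \<epsilon> \<eta> B \<inter> shell_points \<theta> \<epsilon> \<eta> B' = {}"
proof (rule ccontr)
  assume "shell_points \<theta> \<epsilon> \<eta> B \<inter> shell_points \<theta> \<epsilon> \<eta> B' \<noteq> {}"
  then obtain u v where "(u, v) \<in> shell_points \<theta> \<epsilon> \<eta> B" "(u, v) \<in> shell_points \<theta> \<epsilon> \<eta> B'"
    by auto
  then have "\<eta> < B\<^sup>2 * d" "B'\<^sup>2 * d \<le> \<epsilon>" if "d = \<bar>u / v - \<theta>\<bar>" for d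
    using that by (auto simp: shell_points_def abs_mult)
  then have "\<eta> * B'\<^sup>2 < B\<^sup>2 * \<bar>u / v - \<theta>\<bar> * B'\<^sup>2" "B'\<^sup>2 * \<bar>u / v - \<theta>\<bar> * B\<^sup>2 \<le> \<epsilon> * B\<^sup>2"
    using assms(1) by (auto intro: mult_right_mono)
  then show False using assms(2) by (simp add: mult_ac)
qed

text \<open>Choosing the scale \<open>B\<close> with \<open>B\<^sup>2 |h/k - \<theta>| = \<epsilon>\<close> puts a good approximation \<open>h/k\<close> on the outer
  boundary of the shell; \<open>|h/k - \<theta>| < 1/k\<^sup>2\<close> makes its height at most \<open>B\<close>.\<close>
lemma approximation_in_shell_points:
  fixes h k :: int and \<theta> \<epsilon> \<eta> d :: real
  assumes "0 < k" "coprime h k" and d: "d = \<bar>h / k - \<theta>\<bar>" "0 < d" "d * k\<^sup>2 < 1"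
    and "(\<bar>\<theta>\<bar> + 1)\<^sup>2 \<le> \<epsilon>" "\<eta> < \<epsilon>"
  shows "(h, k) \<in> shell_points \<theta> \<epsilon> \<eta> (sqrt (\<epsilon> / d))"
proof -
  define B where "B = sqrt (\<epsilon> / d)"
  have "1 \<le> (\<bar>\<theta>\<bar> + 1)\<^sup>2" by (intro one_le_power) simp
  then have "1 \<le> \<epsilon>" using assms(6) by linarith
  then have B0: "0 < B" and Bd: "B\<^sup>2 * d = \<epsilon>" unfolding B_def using d(2) by simp_all
  have k1: "1 \<le> real_of_int k" using assms(1) by simp
  have "k\<^sup>2 * d < B\<^sup>2 * d" using d(3) \<open>1 \<le> \<epsilon>\<close> Bd by (simp add: mult.commute)
  then have "(real_of_int k)\<^sup>2 < B\<^sup>2" using d(2) by simp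
  then have "real_of_int k \<le> B" using B0 power2_less_imp_less[of "real_of_int k" B] by simp
  have "d * k \<le> d * k\<^sup>2" using d(2) k1 by (simp add: power2_eq_square)
  then have "d * k \<le> k" using d(3) k1 by linarith
  have "\<bar>real_of_int h\<bar> = k * \<bar>h / k\<bar>" using assms(1) by (simp add: abs_divide)
  also have "\<dots> \<le> k * (\<bar>\<theta>\<bar> + d)" using d(1) k1 by (intro mult_left_mono) auto
  also have "\<dots> \<le> (\<bar>\<theta>\<bar> + 1) * k" using \<open>d * k \<le> k\<close> by (simp add: algebra_simps)
  finally have "(real_of_int h)\<^sup>2 \<le> ((\<bar>\<theta>\<bar> + 1) * k)\<^sup>2"
    by (metis abs_ge_zero power2_abs power_mono)
  then have "h\<^sup>2 * d \<le> (\<bar>\<theta>\<bar> + 1)\<^sup>2 * (d * k\<^sup>2)"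
    using d(2) by (simp add: power_mult_distrib mult_right_mono mult.commute mult.left_commute)
  also have "\<dots> \<le> (\<bar>\<theta>\<bar> + 1)\<^sup>2" using d(3) by (simp add: mult_left_le)
  also have "\<dots> \<le> B\<^sup>2 * d" using assms(6) Bd by simp
  finally have "(real_of_int h)\<^sup>2 \<le> B\<^sup>2" using d(2) by simp
  then have "\<bar>real_of_int h\<bar> \<le> B" using B0 by (metis abs_le_square_iff abs_of_pos)
  moreover have "\<bar>B\<^sup>2 * (h / k - \<theta>)\<bar> = \<epsilon>" using Bd d(1) B0 by (simp add: abs_mult)
  ultimately show ?thesis
    using assms \<open>real_of_int k \<le> B\<close>
    unfolding shell_points_def points_of_height_le_def B_def[symmetric] by simp
qed

lemma frequently_shell_points_nonempty:
  assumes "\<theta> \<notin> \<rat>" "(\<bar>\<theta>\<bar> + 1)\<^sup>2 \<le> \<epsilon>" "\<eta> < \<epsilon>"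
  shows "\<exists>\<^sub>F B in at_top. shell_points \<theta> \<epsilon> \<eta> B \<noteq> {}"
  unfolding frequently_at_top_linorder
proof
  fix N :: real
  have "infinite (approx_set \<theta>)" using assms(1) rational_iff_finite_approx_set by blast
  then obtain h k where "(h, k) \<in> approx_set \<theta>" "\<lceil>N\<rceil> < k"
    using infinite_approx_set by blast
  then have hk: "0 < k" "coprime h k" "\<bar>h / k - \<theta>\<bar> * k\<^sup>2 < 1" "N < k"
    by (auto simp: approx_set_def abs_minus_commute pos_less_divide_eq ceiling_less_iff)
  have "real_of_int h / real_of_int k \<noteq> \<theta>" using assms(1) by (metis Rats_divide Rats_of_int)
  then have "0 < \<bar>h / k - \<theta>\<bar>" by simp
  then have hk_mem: "(h, k) \<in> shell_points \<theta> \<epsilon> \<eta> (sqrt (\<epsilon> / \<bar>h / k - \<theta>\<bar>))"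
    (is "_ \<in> shell_points _ _ _ ?B")
    using hk assms by (intro approximation_in_shell_points) auto
  moreover have "real_of_int k \<le> ?B"
    using hk_mem by (force simp: shell_points_def points_of_height_le_def)
  ultimately have "N \<le> ?B" using hk(4) by simp
  then show "\<exists>B\<ge>N. shell_points \<theta> \<epsilon> \<eta> B \<noteq> {}" using hk_mem by blast
qed

text \<open>Points picked from these \<open>n + 1\<close> shells are distinct, have height at most \<open>X \<surd>2\<close> and lie
  within \<open>\<epsilon>/X\<^sup>2\<close> of \<open>\<theta>\<close>; only \<open>4\<epsilon> + 1 < n + 1\<close> such points exist.\<close>
lemma shell_points_empty_at_some_scale:
  fixes \<theta> \<epsilon> \<eta> s X :: real
  assumes "0 < \<eta>" "\<eta> < \<epsilon>" "\<epsilon> \<le> \<eta> * s" "1 \<le> s" "s ^ n \<le> 2" "4 * \<epsilon> < n" "1 \<le> X"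
  shows "\<exists>j\<le>n. shell_points \<theta> \<epsilon> \<eta> (X * sqrt (s ^ j)) = {}"
proof (rule ccontr)
  define scale where "scale j = X * sqrt (s ^ j)" for j :: nat
  assume "\<not> (\<exists>j\<le>n. shell_points \<theta> \<epsilon> \<eta> (X * sqrt (s ^ j)) = {})"
  then have "\<exists>p. p \<in> shell_points \<theta> \<epsilon> \<eta> (scale j)" if "j \<le> n" for j
    using that unfolding scale_def by blast
  then obtain g where g: "g j \<in> shell_points \<theta> \<epsilon> \<eta> (scale j)" if "j \<le> n" for j by metis
  have scale_ge: "X \<le> scale j" for j unfolding scale_def using assms(4,7) by simp
  have scale_le: "scale j \<le> X * sqrt 2" if "j \<le> n" for j
  proof -
    have "s ^ j \<le> 2" using power_increasing[OF that assms(4)] assms(5) by simp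
    then show ?thesis unfolding scale_def using assms(7) by (intro mult_left_mono) auto
  qed
  have "g j \<noteq> g k" if "j < k" "k \<le> n" for j k
  proof -
    have "s * s ^ j \<le> s ^ k" using power_increasing[of "Suc j" k s] assms(4) that by simp
    have "\<epsilon> * (X\<^sup>2 * s ^ j) \<le> (\<eta> * s) * (X\<^sup>2 * s ^ j)" using assms(3,4) by (intro mult_right_mono) auto
    also have "\<dots> = \<eta> * X\<^sup>2 * (s * s ^ j)" by (simp add: mult_ac)
    also have "\<dots> \<le> \<eta> * X\<^sup>2 * s ^ k" using \<open>s * s ^ j \<le> s ^ k\<close> assms(1) by (intro mult_left_mono) auto
    finally have "\<epsilon> * (scale j)\<^sup>2 \<le> \<eta> * (scale k)\<^sup>2"
      unfolding scale_def using assms(4) by (simp add: power_mult_distrib mult.assoc)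
    moreover have "scale k \<noteq> 0" using scale_ge[of k] assms(7) by linarith
    ultimately have "shell_points \<theta> \<epsilon> \<eta> (scale j) \<inter> shell_points \<theta> \<epsilon> \<eta> (scale k) = {}"
      by (rule shell_points_disjoint[rotated])
    then show ?thesis using g[of j] g[of k] that by (metis IntI empty_iff order.strict_implies_order order.trans)
  qed
  then have "inj_on g {..n}" by (metis atMost_iff inj_onI linorder_neqE_nat)
  moreover have "card (g ` {..n}) \<le> 2 * (\<epsilon> / X\<^sup>2) * (X * sqrt 2)\<^sup>2 + 1"
  proof (rule card_reduced_fractions_near[where c = \<theta>])
    fix u v assume "(u, v) \<in> g ` {..n}"
    then obtain j where "j \<le> n" "(u, v) \<in> shell_points \<theta> \<epsilon> \<eta> (scale j)" using g by auto
    moreover have "\<epsilon> / (scale j)\<^sup>2 \<le> \<epsilon> / X\<^sup>2"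
      using assms(1,2,7) scale_ge[of j] by (intro divide_left_mono power_mono) auto
    ultimately show "coprime u v \<and> 0 < v \<and> v \<le> X * sqrt 2 \<and> \<bar>u / v - \<theta>\<bar> \<le> \<epsilon> / X\<^sup>2"
      using shell_pointsD[of u v \<theta> \<epsilon> \<eta> "scale j"] scale_le[of j] scale_ge[of j] assms(7) by auto
  qed (use assms in auto)
  ultimately have "real n + 1 \<le> 4 * \<epsilon> + 1"
    using assms(7) by (simp add: card_image power_mult_distrib)
  then show False using assms(6) by linarith
qed

lemma frequently_shell_points_empty:
  fixes \<theta> \<epsilon> \<eta> :: real
  assumes "0 < \<eta>" "\<eta> < \<epsilon>" "(\<epsilon> / \<eta>) ^ (nat \<lfloor>4 * \<epsilon>\<rfloor> + 1) < 2"
  shows "\<exists>\<^sub>F B in at_top. shell_points \<theta> \<epsilon> \<eta> B = {}"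
  unfolding frequently_at_top_linorder
proof
  fix N :: real
  define n where "n = nat \<lfloor>4 * \<epsilon>\<rfloor> + 1"
  define s where "s = 2 powr (1 / n)"
  have "s ^ n = s powr n" unfolding s_def by (simp add: powr_realpow)
  then have s_n: "s ^ n = 2" unfolding s_def n_def by (simp add: powr_powr)
  have "\<epsilon> / \<eta> < s"
  proof (rule ccontr)
    assume "\<not> \<epsilon> / \<eta> < s"
    then have "s ^ n \<le> (\<epsilon> / \<eta>) ^ n" unfolding s_def by (intro power_mono) auto
    then show False using assms(3) s_n unfolding n_def by simp
  qed
  then have "\<epsilon> \<le> \<eta> * s" using assms(1) by (simp add: pos_divide_less_eq mult.commute)
  moreover have "1 \<le> s" unfolding s_def by (rule ge_one_powr_ge_zero) auto
  moreover have "4 * \<epsilon> < n" unfolding n_def by linarith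
  ultimately obtain j where "shell_points \<theta> \<epsilon> \<eta> (max N 1 * sqrt (s ^ j)) = {}"
    using shell_points_empty_at_some_scale[of \<eta> \<epsilon> s n "max N 1" \<theta>] assms s_n by auto
  moreover have "N \<le> max N 1 * sqrt (s ^ j)"
    using \<open>1 \<le> s\<close> mult_left_mono[of 1 "sqrt (s ^ j)" "max N 1"] by simp
  ultimately show "\<exists>B\<ge>N. shell_points \<theta> \<epsilon> \<eta> B = {}" by blast
qed

lemma exists_thin_shell:
  fixes \<eta> D :: real
  assumes "0 < \<eta>" "0 < D"
  shows "\<exists>\<epsilon>>\<eta>. \<epsilon> - \<eta> < D \<and> (\<epsilon> / \<eta>) ^ (nat \<lfloor>4 * \<epsilon>\<rfloor> + 1) < 2"
proof -
  define n where "n = nat \<lfloor>4 * (\<eta> + 1)\<rfloor> + 1"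
  have "((\<lambda>\<epsilon>. (\<epsilon> / \<eta>) ^ n) \<longlongrightarrow> (\<eta> / \<eta>) ^ n) (at_right \<eta>)"
    using assms(1) by (intro tendsto_intros) auto
  moreover have "(\<eta> / \<eta>) ^ n < (2 :: real)" using assms(1) by simp
  ultimately have "\<forall>\<^sub>F \<epsilon> in at_right \<eta>. (\<epsilon> / \<eta>) ^ n < 2" by (rule order_tendstoD(2))
  moreover have "\<forall>\<^sub>F \<epsilon> in at_right \<eta>. \<epsilon> \<in> {\<eta><..<\<eta> + min D 1}"
    using assms by (intro eventually_at_right_real) simp
  ultimately obtain \<epsilon> where \<epsilon>: "(\<epsilon> / \<eta>) ^ n < 2" "\<epsilon> \<in> {\<eta><..<\<eta> + min D 1}"
    using eventually_happens'[OF trivial_limit_at_right_real eventually_conj] by blast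
  have "nat \<lfloor>4 * \<epsilon>\<rfloor> \<le> nat \<lfloor>4 * (\<eta> + 1)\<rfloor>" using \<epsilon>(2) by (intro nat_mono floor_mono) auto
  then have "nat \<lfloor>4 * \<epsilon>\<rfloor> + 1 \<le> n" unfolding n_def by simp
  then have "(\<epsilon> / \<eta>) ^ (nat \<lfloor>4 * \<epsilon>\<rfloor> + 1) \<le> (\<epsilon> / \<eta>) ^ n"
    using \<epsilon>(2) assms(1) by (intro power_increasing) auto
  then show ?thesis using \<epsilon> by auto
qed

lemma eventually_delta_chi_eq_card_shell_points:
  "\<forall>\<^sub>F B in at_top. ereal (delta \<theta> B (1/2) (chi \<epsilon> \<eta>)) = card (shell_points \<theta> \<epsilon> \<eta> B)"
  using eventually_gt_at_top[of 0] by eventually_elim (simp add: delta_chi_eq_card_shell_points)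

lemma Liminf_delta_chi_eq_0:
  fixes \<theta> \<epsilon> \<eta> :: real
  assumes "0 < \<eta>" "\<eta> < \<epsilon>" "(\<epsilon> / \<eta>) ^ (nat \<lfloor>4 * \<epsilon>\<rfloor> + 1) < 2"
  shows "Liminf at_top (\<lambda>B. ereal (delta \<theta> B (1/2) (chi \<epsilon> \<eta>))) = 0"
proof (rule antisym)
  note card_eq = eventually_delta_chi_eq_card_shell_points[of \<theta> \<epsilon> \<eta>]
  have "\<exists>\<^sub>F B in at_top. ereal (delta \<theta> B (1/2) (chi \<epsilon> \<eta>)) \<le> 0"
    using frequently_shell_points_empty[OF assms, of \<theta>]
    by (rule frequently_rev_mp) (use card_eq in \<open>eventually_elim, simp\<close>)
  then show "Liminf at_top (\<lambda>B. ereal (delta \<theta> B (1/2) (chi \<epsilon> \<eta>))) \<le> 0"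
    by (rule Liminf_le_if_frequently)
  have "\<forall>\<^sub>F B in at_top. 0 \<le> ereal (delta \<theta> B (1/2) (chi \<epsilon> \<eta>))"
    using card_eq by eventually_elim simp
  then show "0 \<le> Liminf at_top (\<lambda>B. ereal (delta \<theta> B (1/2) (chi \<epsilon> \<eta>)))"
    by (rule Liminf_bounded)
qed

lemma Limsup_delta_chi_ge_1:
  assumes "\<theta> \<notin> \<rat>" "(\<bar>\<theta>\<bar> + 1)\<^sup>2 \<le> \<epsilon>" "\<eta> < \<epsilon>"
  shows "1 \<le> Limsup at_top (\<lambda>B. ereal (delta \<theta> B (1/2) (chi \<epsilon> \<eta>)))"
proof (rule Limsup_ge_if_frequently)
  show "\<exists>\<^sub>F B in at_top. 1 \<le> ereal (delta \<theta> B (1/2) (chi \<epsilon> \<eta>))"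
    using frequently_shell_points_nonempty[OF assms]
    by (rule frequently_rev_mp)
      (use eventually_delta_chi_eq_card_shell_points[of \<theta> \<epsilon> \<eta>] in
        \<open>eventually_elim, simp add: Suc_le_eq card_gt_0_iff finite_shell_points\<close>)
qed

lemma Limsup_delta_chi_le:
  fixes \<epsilon> :: real
  assumes "0 \<le> \<epsilon>"
  shows "Limsup at_top (\<lambda>B. ereal (delta \<theta> B (1/2) (chi \<epsilon> \<eta>))) \<le> 2 * \<epsilon> + 1"
proof (rule Limsup_bounded)
  show "\<forall>\<^sub>F B in at_top. ereal (delta \<theta> B (1/2) (chi \<epsilon> \<eta>)) \<le> 2 * \<epsilon> + 1"
    using eventually_delta_chi_eq_card_shell_points[of \<theta> \<epsilon> \<eta>] eventually_gt_at_top[of 0]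
  proof eventually_elim
    case (elim B)
    then show ?case using card_shell_points_le[of B \<epsilon>] assms by simp
  qed
qed

theorem mainTheorem6:
  fixes a b :: nat and C D :: real
  assumes "0 < a" and "a < b" and "coprime a b"
    and "\<not> ((\<exists>k. a = k ^ 2) \<and> (\<exists>k. b = k ^ 2))"
    and "C > 0" and "D > 0"
  shows "\<exists>\<epsilon> \<eta>. C < \<eta> \<and> \<eta> < \<epsilon> \<and> \<epsilon> - \<eta> < D \<and>
     Liminf at_top (\<lambda>B. ereal (delta (sqrt (real b / real a)) B (1/2) (chi \<epsilon> \<eta>))) = 0 \<and>
     0 < Limsup at_top (\<lambda>B. ereal (delta (sqrt (real b / real a)) B (1/2) (chi \<epsilon> \<eta>))) \<and>
     Limsup at_top (\<lambda>B. ereal (delta (sqrt (real b / real a)) B (1/2) (chi \<epsilon> \<eta>))) < \<infinity>"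
proof -
  define \<theta> where "\<theta> = sqrt (real b / real a)"
  have irrational: "\<theta> \<notin> \<rat>" unfolding \<theta>_def using assms(1-4) by (intro sqrt_ratio_irrational) auto
  define \<eta> where "\<eta> = C + (\<bar>\<theta>\<bar> + 1)\<^sup>2"
  have "C < \<eta>" unfolding \<eta>_def by (simp add: add_pos_nonneg)
  obtain \<epsilon> where \<epsilon>: "\<eta> < \<epsilon>" "\<epsilon> - \<eta> < D" "(\<epsilon> / \<eta>) ^ (nat \<lfloor>4 * \<epsilon>\<rfloor> + 1) < 2"
    using exists_thin_shell[of \<eta> D] \<open>C < \<eta>\<close> assms(5,6) by auto
  have "(\<bar>\<theta>\<bar> + 1)\<^sup>2 \<le> \<epsilon>" using \<epsilon>(1) assms(5) unfolding \<eta>_def by simp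
  have "Liminf at_top (\<lambda>B. ereal (delta \<theta> B (1/2) (chi \<epsilon> \<eta>))) = 0"
    using \<open>C < \<eta>\<close> assms(5) \<epsilon>(1,3) by (intro Liminf_delta_chi_eq_0) auto
  moreover have "0 < Limsup at_top (\<lambda>B. ereal (delta \<theta> B (1/2) (chi \<epsilon> \<eta>)))"
    using Limsup_delta_chi_ge_1[OF irrational \<open>(\<bar>\<theta>\<bar> + 1)\<^sup>2 \<le> \<epsilon>\<close> \<epsilon>(1)]
    by (rule order.strict_trans2[rotated]) simp
  moreover have "Limsup at_top (\<lambda>B. ereal (delta \<theta> B (1/2) (chi \<epsilon> \<eta>))) < \<infinity>"
  proof (rule order.strict_trans1)
    show "Limsup at_top (\<lambda>B. ereal (delta \<theta> B (1/2) (chi \<epsilon> \<eta>))) \<le> 2 * \<epsilon> + 1"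
      using \<open>C < \<eta>\<close> \<epsilon>(1) assms(5) by (intro Limsup_delta_chi_le) simp
  qed simp
  ultimately show ?thesis using \<open>C < \<eta>\<close> \<epsilon>(1,2) unfolding \<theta>_def by blast
qed

end
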